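(* Let $\mathbf{v}_1,\mathbf{v}_2,\mathbf{v}_3\in\mathbb{R}^2$ be the vectors of a regular $2$-simplex frame, and let $$\mathcal{T}=\mathbf{v}_1^{\otimes d}+\mathbf{v}_2^{\otimes d}+\mathbf{v}_3^{\otimes d}.$$ If $\mathbf{x}_0\in\mathbb{R}^2$ and there is a unique $\mathbf{v}\in\{\mathbf{v}_1,-\mathbf{v}_1,\mathbf{v}_2,-\mathbf{v}_2,\mathbf{v}_3,-\mathbf{v}_3\}$ which maximizes $\langle\mathbf{v},\mathbf{x}_0\rangle$, then, for all even $d\geq 6$, the tensor power method applied to $\mathcal{T}$ with initializing vector $\mathbf{x}_0$ converges to $\mathbf{v}$. If $d=4$, then any initializing vector $\mathbf{x}_0\in\mathbb{R}^2$, $\mathbf{x}_0\neq 0$, is a fixed point of the tensor power method (up to normalization, i.e. $\mathbf{x}_1=\mathbf{x}_0/\|\mathbf{x}_0\|$).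
   Context: A regular $2$-simplex frame consists of three unit vectors $\mathbf{v}_1,\mathbf{v}_2,\mathbf{v}_3\in\mathbb{R}^2$ with $\langle\mathbf{v}_i,\mathbf{v}_j\rangle=-\frac12$ for all $i\neq j$ (the vertices of an equilateral triangle centered at the origin). For a real symmetric tensor $\mathcal{T}$ of order $d$ and dimension $n$ and $\mathbf{x}\in\mathbb{R}^n$, $\mathcal{T}\cdot\mathbf{x}^{d-1}\in\mathbb{R}^n$ is the vector with $i$-th entry $\sum_{i_1,\ldots,i_{d-1}=1}^n \mathcal{T}_{i_1\cdots i_{d-1} i}\,x_{i_1}\cdots x_{i_{d-1}}$; for $\mathcal{T}=\sum_i\mathbf{v}_i^{\otimes d}$ this is $\sum_i\langle\mathbf{v}_i,\mathbf{x}\rangle^{d-1}\mathbf{v}_i$. The tensor power method for $\mathcal{T}$ with initializing vector $\mathbf{x}_0$ is the iteration $\mathbf{x}_{k+1}=\mathcal{T}\cdot\mathbf{x}_k^{d-1}/\|\mathcal{T}\cdot\mathbf{x}_k^{d-1}\|$, $k\geq 0$. Initializing vectors are real and non-zero. *)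

theory Defs
  imports "HOL-Analysis.Analysis" "HOL-Library.Function_Algebras"
begin

text \<open>
  A real tensor of order \<open>d\<close> over \<open>real ^ 'n\<close> is represented by its entries: a function on index
  lists, of which only those of length \<open>d\<close> matter. The order is not part of the type and is
  therefore passed explicitly; addition of tensors is pointwise.
\<close>

type_synonym 'n tensor = "'n list \<Rightarrow> real"

definition tensor_power :: "nat \<Rightarrow> real ^ 'n \<Rightarrow> ('n::finite) tensor" where
  "tensor_power d v = (\<lambda>is. if length is = d then (\<Prod>i\<leftarrow>is. v $ i) else 0)"

definition tensor_contract :: "nat \<Rightarrow> ('n::finite) tensor \<Rightarrow> real ^ 'n \<Rightarrow> real ^ 'n" where
  "tensor_contract d T x =
     (\<chi> i. \<Sum>is | length is = d - 1. T (is @ [i]) * (\<Prod>j\<leftarrow>is. x $ j))"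

text \<open>
  Where the contraction vanishes, the method is undefined mathematically; here the next iterate is
  then 0 (and, for \<open>d \<ge> 2\<close>, so are all later ones), so that such a run never converges
  to a unit vector.
\<close>

primrec tensor_power_method ::
  "nat \<Rightarrow> ('n::finite) tensor \<Rightarrow> real ^ 'n \<Rightarrow> nat \<Rightarrow> real ^ 'n" where
  "tensor_power_method d T x\<^sub>0 0 = x\<^sub>0"
| "tensor_power_method d T x\<^sub>0 (Suc k) =
     (let y = tensor_contract d T (tensor_power_method d T x\<^sub>0 k) in y /\<^sub>R norm y)"

definition regular_2_simplex_frame :: "real ^ 2 \<Rightarrow> real ^ 2 \<Rightarrow> real ^ 2 \<Rightarrow> bool" where
  "regular_2_simplex_frame v\<^sub>1 v\<^sub>2 v\<^sub>3 \<longleftrightarrow>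
     norm v\<^sub>1 = 1 \<and> norm v\<^sub>2 = 1 \<and> norm v\<^sub>3 = 1 \<and>
     v\<^sub>1 \<bullet> v\<^sub>2 = - (1 / 2) \<and> v\<^sub>1 \<bullet> v\<^sub>3 = - (1 / 2) \<and> v\<^sub>2 \<bullet> v\<^sub>3 = - (1 / 2)"

definition frame_tensor :: "nat \<Rightarrow> real ^ 2 \<Rightarrow> real ^ 2 \<Rightarrow> real ^ 2 \<Rightarrow> 2 tensor" where
  "frame_tensor d v\<^sub>1 v\<^sub>2 v\<^sub>3 = tensor_power d v\<^sub>1 + tensor_power d v\<^sub>2 + tensor_power d v\<^sub>3"

end

theory Submission
  imports Defs
begin

text \<open>
  Up to symmetry the maximizer is \<open>v\<^sub>1\<close>. For \<open>d\<close> even put \<open>a = - \<langle>v\<^sub>2, x\<rangle>\<close> and \<open>b = - \<langle>v\<^sub>3, x\<rangle>\<close>; since the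
  frame sums to zero, \<open>\<langle>v\<^sub>1, x\<rangle> = a + b\<close>, and uniqueness of the maximizer says \<open>a, b > 0\<close>. The
  ratio \<open>r = (a - b) / (a + b)\<close> is the tangent of the angle between \<open>x\<close> and \<open>v\<^sub>1\<close> up to a factor
  \<open>\<surd>3\<close>, and a step of the method turns it into
  \<open>r' = 3 (a\<^sup>m - b\<^sup>m) / (2 (a + b)\<^sup>m + a\<^sup>m + b\<^sup>m)\<close> with \<open>m = d - 1\<close>. For \<open>m = 3\<close> this is \<open>r\<close> again, and
  for \<open>m \<ge> 5\<close> one has \<open>\<bar>r'\<bar> \<le> \<bar>r\<bar> (2 + r\<^sup>2) / 3\<close>, hence geometric convergence of \<open>r\<close> to 0.
\<close>

section \<open>Contraction of the frame tensor\<close>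

text \<open>Expanding the power by distributivity gives one monomial per index list. This is what
  collapses the contraction of a rank-one tensor to a power of an inner product.\<close>

lemma sum_prod_list_length:
  fixes f :: "'n::finite \<Rightarrow> 'a::comm_semiring_1"
  shows "(\<Sum>is | length is = n. \<Prod>i\<leftarrow>is. f i) = (\<Sum>i\<in>UNIV. f i) ^ n"
proof (induction n)
  case 0
  then show ?case by simp
next
  case (Suc n)
  have "{is :: 'n list. length is = Suc n} = (\<lambda>(i, is). i # is) ` (UNIV \<times> {is. length is = n})"
    by (auto simp: length_Suc_conv)
  moreover have "inj_on (\<lambda>(i :: 'n, is). i # is) (UNIV \<times> {is. length is = n})"
    by (auto simp: inj_on_def)
  ultimately have "(\<Sum>is | length is = Suc n. \<Prod>i\<leftarrow>is. f i)
      = (\<Sum>(i, is)\<in>UNIV \<times> {is. length is = n}. f i * (\<Prod>i\<leftarrow>is. f i))"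
    by (simp add: sum.reindex case_prod_unfold)
  also have "\<dots> = (\<Sum>i\<in>UNIV. f i) * (\<Sum>is | length is = n. \<Prod>i\<leftarrow>is. f i)"
    by (simp add: sum.cartesian_product[symmetric] sum_product)
  finally show ?case using Suc by simp
qed

lemma tensor_contract_add:
  "tensor_contract d (S + T) x = tensor_contract d S x + tensor_contract d T x"
  by (simp add: tensor_contract_def vec_eq_iff distrib_right sum.distrib)

lemma tensor_contract_tensor_power:
  assumes "d > 0"
  shows "tensor_contract d (tensor_power d v) x = (v \<bullet> x) ^ (d - 1) *\<^sub>R v"
proof -
  have prod: "(\<Prod>j\<leftarrow>is. v $ j) * (\<Prod>j\<leftarrow>is. x $ j) = (\<Prod>j\<leftarrow>is. v $ j * x $ j)" for "is"
    by (induction "is") (simp_all add: mult_ac)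
  have "(\<Sum>is | length is = d - 1. tensor_power d v (is @ [i]) * (\<Prod>j\<leftarrow>is. x $ j))
      = (v \<bullet> x) ^ (d - 1) * v $ i" for i
  proof -
    have "(\<Sum>is | length is = d - 1. tensor_power d v (is @ [i]) * (\<Prod>j\<leftarrow>is. x $ j))
        = (\<Sum>is | length is = d - 1. (\<Prod>j\<leftarrow>is. v $ j * x $ j) * v $ i)"
      using assms by (intro sum.cong) (auto simp: tensor_power_def prod[symmetric])
    also have "\<dots> = (v \<bullet> x) ^ (d - 1) * v $ i"
      by (simp add: sum_distrib_right[symmetric] sum_prod_list_length inner_vec_def)
    finally show ?thesis .
  qed
  then show ?thesis by (simp add: tensor_contract_def vec_eq_iff)
qed

lemma tensor_contract_frame_tensor:
  assumes "d > 0"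
  shows "tensor_contract d (frame_tensor d v\<^sub>1 v\<^sub>2 v\<^sub>3) x
    = (v\<^sub>1 \<bullet> x) ^ (d - 1) *\<^sub>R v\<^sub>1 + (v\<^sub>2 \<bullet> x) ^ (d - 1) *\<^sub>R v\<^sub>2 + (v\<^sub>3 \<bullet> x) ^ (d - 1) *\<^sub>R v\<^sub>3"
  using assms by (simp add: frame_tensor_def tensor_contract_add tensor_contract_tensor_power)

lemma tensor_power_minus:
  assumes "even d"
  shows "tensor_power d (- v) = tensor_power d v"
proof -
  have "(\<Prod>i\<leftarrow>is. (- v) $ i) = (- 1) ^ length is * (\<Prod>i\<leftarrow>is. v $ i)" for "is"
    by (induction "is") simp_all
  then show ?thesis using assms
    by (simp add: tensor_power_def fun_eq_iff del: vector_uminus_component)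
qed

section \<open>Regular simplex frames in the plane\<close>

lemma regular_2_simplex_frame_inner:
  assumes "regular_2_simplex_frame v\<^sub>1 v\<^sub>2 v\<^sub>3"
  shows "v\<^sub>1 \<bullet> v\<^sub>1 = 1" "v\<^sub>2 \<bullet> v\<^sub>2 = 1" "v\<^sub>3 \<bullet> v\<^sub>3 = 1"
    "v\<^sub>1 \<bullet> v\<^sub>2 = - (1 / 2)" "v\<^sub>1 \<bullet> v\<^sub>3 = - (1 / 2)" "v\<^sub>2 \<bullet> v\<^sub>3 = - (1 / 2)"
    "v\<^sub>2 \<bullet> v\<^sub>1 = - (1 / 2)" "v\<^sub>3 \<bullet> v\<^sub>1 = - (1 / 2)" "v\<^sub>3 \<bullet> v\<^sub>2 = - (1 / 2)"
  using assms by (simp_all add: regular_2_simplex_frame_def norm_eq_1 inner_commute)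

text \<open>The squared norm of the sum of the frame is \<open>3 - 6 / 2 = 0\<close>.\<close>

lemma regular_2_simplex_frame_sum:
  assumes "regular_2_simplex_frame v\<^sub>1 v\<^sub>2 v\<^sub>3"
  shows "v\<^sub>1 = - v\<^sub>2 - v\<^sub>3"
proof -
  have "(v\<^sub>1 + v\<^sub>2 + v\<^sub>3) \<bullet> (v\<^sub>1 + v\<^sub>2 + v\<^sub>3) = 0"
    by (simp add: inner_add_left inner_add_right regular_2_simplex_frame_inner[OF assms])
  then have "v\<^sub>1 + v\<^sub>2 + v\<^sub>3 = 0" by (simp only: inner_eq_zero_iff)
  then show ?thesis by (simp add: algebra_simps eq_neg_iff_add_eq_0)
qed

lemma orthonormal_expansion_2:
  fixes v w x :: "real ^ 2"
  assumes "v \<bullet> v = 1" "w \<bullet> w = 1" "v \<bullet> w = 0"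
  shows "x = (v \<bullet> x) *\<^sub>R v + (w \<bullet> x) *\<^sub>R w"
proof -
  have v: "v$1 * v$1 + v$2 * v$2 = 1" and w: "w$1 * w$1 + w$2 * w$2 = 1"
    and vw: "v$1 * w$1 + v$2 * w$2 = 0"
    using assms by (simp_all add: inner_vec_def sum_2)
  \<comment> \<open>The matrix with rows \<open>v\<close> and \<open>w\<close> is orthogonal, so its
    columns are orthonormal too; these identities encode that.\<close>
  have "w$1 * w$1 = v$2 * v$2" "w$2 * w$2 = v$1 * v$1" "v$1 * v$2 + w$1 * w$2 = 0"
    using v w vw by algebra+
  then have "x$1 = (v$1 * x$1 + v$2 * x$2) * v$1 + (w$1 * x$1 + w$2 * x$2) * w$1"
    "x$2 = (v$1 * x$1 + v$2 * x$2) * v$2 + (w$1 * x$1 + w$2 * x$2) * w$2"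
    using v by algebra+
  then show ?thesis by (simp add: vec_eq_iff forall_2 inner_vec_def sum_2)
qed

text \<open>The vector \<open>v\<^sub>3 - v\<^sub>2\<close> is orthogonal to
  \<open>v\<^sub>1\<close> and has squared norm 3, which explains the division by 3.\<close>

lemma regular_2_simplex_frame_expansion:
  assumes "regular_2_simplex_frame v\<^sub>1 v\<^sub>2 v\<^sub>3"
  shows "x = (v\<^sub>1 \<bullet> x) *\<^sub>R v\<^sub>1 + (((v\<^sub>3 - v\<^sub>2) \<bullet> x) / 3) *\<^sub>R (v\<^sub>3 - v\<^sub>2)"
proof -
  let ?w = "(1 / sqrt 3) *\<^sub>R (v\<^sub>3 - v\<^sub>2)"
  note inner = regular_2_simplex_frame_inner[OF assms]
  have "x = (v\<^sub>1 \<bullet> x) *\<^sub>R v\<^sub>1 + (?w \<bullet> x) *\<^sub>R ?w"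
    by (rule orthonormal_expansion_2) (simp_all add: inner inner_diff_left inner_diff_right)
  also have "(?w \<bullet> x) *\<^sub>R ?w = (((v\<^sub>3 - v\<^sub>2) \<bullet> x) / 3) *\<^sub>R (v\<^sub>3 - v\<^sub>2)"
    by simp
  finally show ?thesis .
qed

section \<open>Contraction of the angle\<close>

lemma power_diff_le_aux:
  fixes p q :: real
  assumes "p + q = 1" "0 \<le> q" "q \<le> p" "m \<ge> 5"
  shows "3 * (p ^ m - q ^ m) \<le> (p - q) * (2 + p ^ m + q ^ m - 4 * (p * q))"
proof -
  \<comment> \<open>Since \<open>p + q = 1\<close>, both \<open>p ^ m\<close> and \<open>q ^ m\<close> satisfy the recurrence \<open>z (m + 2) = z (m + 1) - p q z m\<close>;
    hence so does \<open>G\<close>, and \<open>G \<le> 0\<close> makes \<open>G\<close> nondecreasing.\<close>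
  define G where "G m = (p - q) * (p ^ m + q ^ m) - 3 * (p ^ m - q ^ m)" for m
  have p: "p = 1 - q" using assms by simp
  have rec: "G (Suc (Suc m)) = G (Suc m) - p * q * G m" for m
    unfolding G_def p by (simp add: algebra_simps)
  have nonpos: "G (Suc m) \<le> 0" for m
  proof -
    define A B where "A = p * q * (p ^ m - q ^ m)" and "B = p ^ Suc m - q ^ Suc m"
    have "G (Suc m) = - 2 * A - 2 * B"
      unfolding G_def A_def B_def p by (simp add: algebra_simps)
    moreover have "0 \<le> A" "0 \<le> B"
      using assms power_mono[of q p m] power_mono[of q p "Suc m"] by (auto simp: A_def B_def)
    ultimately show ?thesis by linarith
  qed
  from \<open>m \<ge> 5\<close> have "G m \<ge> (p - q) * (4 * (p * q) - 2)"
  proof (induction m rule: dec_induct)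
    case base
    \<comment> \<open>The exponent 5 is the first at which the bound holds for all such
      \<open>p\<close>, \<open>q\<close>: at 3 one gets exactly \<open>- 2 * (p - q)\<close>,
      matching the stationary case \<open>d = 4\<close>.\<close>
    have "G 5 - (p - q) * (4 * (p * q) - 2) = 2 * (p - q) * (p * q)\<^sup>2"
      unfolding G_def p by (simp add: algebra_simps eval_nat_numeral)
    also have "\<dots> \<ge> 0" using assms by simp
    finally show ?case by simp
  next
    case (step n)
    then obtain l where n: "n = Suc (Suc l)" by (auto simp: le_iff_add numeral_eq_Suc)
    have "p * q * G (Suc l) \<le> 0"
      using nonpos[of l] assms by (intro mult_nonneg_nonpos) auto
    then show ?case using step.IH rec[of "Suc l"] by (simp add: n)
  qed
  then show ?thesis by (simp add: G_def algebra_simps)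
qed

text \<open>By homogeneity one may scale to \<open>p + q = 1\<close>, where the ratio becomes
  \<open>p - q\<close>. The bound on the next ratio is stated multiplied out by its positive
  denominator.\<close>

lemma power_diff_le:
  fixes a b :: real
  assumes "0 < a" "0 < b" "m \<ge> 5"
  shows "\<bar>3 * (a ^ m - b ^ m)\<bar>
    \<le> (2 * (a + b) ^ m + a ^ m + b ^ m) * (\<bar>(a - b) / (a + b)\<bar> * (2 + ((a - b) / (a + b))\<^sup>2) / 3)"
  using assms(1,2)
proof (induction a b rule: linorder_wlog)
  case (sym a b)
  then show ?case
    by (simp add: add.commute abs_minus_commute power2_commute power_divide
        add.left_commute abs_divide abs_mult)
next
  \<comment> \<open>The names are swapped: \<open>b\<close> is now the first argument of the claim
    and \<open>b \<le> a\<close>, so that \<open>p\<close> is the larger share.\<close>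
  case (le b a)
  define c where "c = b + a"
  define p q where "p = a / c" and "q = b / c"
  have c: "c > 0" using le by (simp add: c_def)
  have ab: "a = c * p" "b = c * q" using c by (simp_all add: p_def q_def)
  have pq: "p + q = 1" "0 \<le> q" "q \<le> p"
    using c le by (simp_all add: p_def q_def c_def divide_right_mono flip: add_divide_distrib)
  have "p ^ m \<le> p" "q ^ m \<le> q"
    using pq \<open>m \<ge> 5\<close> by (auto intro!: power_le_one_iff power_decreasing[of 1 m, simplified])
  then have s: "p ^ m + q ^ m \<le> 1" using pq by simp
  have "3 * (p ^ m - q ^ m) \<le> (p - q) * (2 + p ^ m + q ^ m - 4 * (p * q))"
    using power_diff_le_aux pq \<open>m \<ge> 5\<close> by blast
  \<comment> \<open>The common factor \<open>2 + p ^ m + q ^ m\<close> is at most 3, so pulling it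
    out only enlarges the right-hand side.\<close>
  also have "\<dots> \<le> (p - q) * ((2 + p ^ m + q ^ m) * (1 - 4 / 3 * (p * q)))"
  proof (rule mult_left_mono)
    have "(p * q) * (p ^ m + q ^ m) \<le> (p * q) * 1"
      using s pq by (intro mult_left_mono) auto
    then show "2 + p ^ m + q ^ m - 4 * (p * q) \<le> (2 + p ^ m + q ^ m) * (1 - 4 / 3 * (p * q))"
      by (simp add: algebra_simps)
  qed (use pq in simp)
  also have "1 - 4 / 3 * (p * q) = (2 + (p - q)\<^sup>2) / 3"
  proof -
    have p: "p = 1 - q" using pq by simp
    show ?thesis unfolding p by (simp add: power2_eq_square field_simps)
  qed
  finally have le_pq: "3 * (p ^ m - q ^ m)
      \<le> (p - q) * ((2 + p ^ m + q ^ m) * ((2 + (p - q)\<^sup>2) / 3))" .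
  have "a ^ m \<ge> b ^ m" using le by (intro power_mono) auto
  then have "\<bar>3 * (b ^ m - a ^ m)\<bar> = c ^ m * (3 * (p ^ m - q ^ m))"
    by (simp add: ab power_mult_distrib algebra_simps)
  also have "\<dots> \<le> c ^ m * ((p - q) * ((2 + p ^ m + q ^ m) * ((2 + (p - q)\<^sup>2) / 3)))"
    using c le_pq by (intro mult_left_mono) auto
  also have "\<dots> = (2 * c ^ m + b ^ m + a ^ m) * ((p - q) * (2 + (p - q)\<^sup>2) / 3)"
    by (simp add: ab power_mult_distrib algebra_simps)
  also have "p - q = \<bar>(b - a) / c\<bar>"
    using c le by (simp add: p_def q_def diff_divide_distrib[symmetric] abs_divide)
  finally show ?case unfolding c_def power2_abs .
qed

section \<open>Convergence\<close>

lemma tensor_power_method_tendsto: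
  fixes v\<^sub>1 v\<^sub>2 v\<^sub>3 x\<^sub>0 :: "real ^ 2"
  assumes frame: "regular_2_simplex_frame v\<^sub>1 v\<^sub>2 v\<^sub>3"
    and d: "even d" "d \<ge> 6"
    and x\<^sub>0: "v\<^sub>2 \<bullet> x\<^sub>0 < 0" "v\<^sub>3 \<bullet> x\<^sub>0 < 0"
  shows "tensor_power_method d (frame_tensor d v\<^sub>1 v\<^sub>2 v\<^sub>3) x\<^sub>0 \<longlonglongrightarrow> v\<^sub>1"
proof -
  define m where "m = d - 1"
  have m: "odd m" "m \<ge> 5" using d by (auto simp: m_def)
  define F where "F = tensor_contract d (frame_tensor d v\<^sub>1 v\<^sub>2 v\<^sub>3)"
  define X where "X = tensor_power_method d (frame_tensor d v\<^sub>1 v\<^sub>2 v\<^sub>3) x\<^sub>0"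
  \<comment> \<open>Positive scaling leaves \<open>r\<close> unchanged, so the normalization in each
    step can be ignored when tracking it.\<close>
  define r where "r x = (v\<^sub>3 - v\<^sub>2) \<bullet> x / (v\<^sub>1 \<bullet> x)" for x
  note inner = regular_2_simplex_frame_inner[OF frame]
  have F: "F x = (v\<^sub>1 \<bullet> x) ^ m *\<^sub>R v\<^sub>1 + (v\<^sub>2 \<bullet> x) ^ m *\<^sub>R v\<^sub>2 + (v\<^sub>3 \<bullet> x) ^ m *\<^sub>R v\<^sub>3" for x
    using d unfolding F_def m_def by (intro tensor_contract_frame_tensor) auto
  have X_Suc: "X (Suc k) = F (X k) /\<^sub>R norm (F (X k))" for k
    by (simp add: X_def F_def Let_def)
  have v1_inner: "v\<^sub>1 \<bullet> x = - (v\<^sub>2 \<bullet> x) - v\<^sub>3 \<bullet> x" for x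
    by (subst regular_2_simplex_frame_sum[OF frame]) (simp add: inner_diff_left)

  \<comment> \<open>The two hypotheses together amount to \<open>a > 0\<close> and
    \<open>b > 0\<close>, the form in which \<open>power_diff_le\<close> applies.\<close>
  have step: "v\<^sub>1 \<bullet> F x > 0 \<and> \<bar>r (F x)\<bar> \<le> \<bar>r x\<bar> * (2 + (r x)\<^sup>2) / 3"
    if c: "v\<^sub>1 \<bullet> x > 0" and r: "\<bar>r x\<bar> < 1" for x
  proof -
    define a b where "a = - (v\<^sub>2 \<bullet> x)" and "b = - (v\<^sub>3 \<bullet> x)"
    have x: "v\<^sub>1 \<bullet> x = a + b" "v\<^sub>2 \<bullet> x = - a" "v\<^sub>3 \<bullet> x = - b"
      by (simp_all add: v1_inner a_def b_def)
    have rx: "r x = (a - b) / (a + b)" by (simp add: r_def x inner_diff_left)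
    with r c x have "\<bar>a - b\<bar> < a + b" by (simp add: abs_divide)
    then have ab: "a > 0" "b > 0" by linarith+
    let ?C = "2 * (a + b) ^ m + a ^ m + b ^ m"
    have C: "?C > 0" using ab by (simp add: add_pos_pos)
    have Fx: "F x = (a + b) ^ m *\<^sub>R v\<^sub>1 - a ^ m *\<^sub>R v\<^sub>2 - b ^ m *\<^sub>R v\<^sub>3"
      using m by (simp add: F x)
    have v1F: "v\<^sub>1 \<bullet> F x = ?C / 2"
      by (simp add: Fx inner_diff_right inner)
    have "(v\<^sub>3 - v\<^sub>2) \<bullet> F x = 3 * (a ^ m - b ^ m) / 2"
      by (simp add: Fx inner_diff_left inner_diff_right inner algebra_simps)
    then have "\<bar>r (F x)\<bar> = \<bar>3 * (a ^ m - b ^ m)\<bar> / ?C"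
      using C by (simp add: r_def v1F abs_divide)
    also have "\<dots> \<le> \<bar>r x\<bar> * (2 + (r x)\<^sup>2) / 3"
      using power_diff_le[OF ab \<open>m \<ge> 5\<close>] C unfolding rx
      by (subst pos_divide_le_eq) (simp_all add: mult.commute)
    finally show ?thesis using C v1F by simp
  qed

  \<comment> \<open>This is the contraction factor at the start. It bounds all later factors because
    \<open>\<bar>r (X k)\<bar>\<close> never exceeds its initial value.\<close>
  define \<rho> where "\<rho> = (2 + (r x\<^sub>0)\<^sup>2) / 3"
  have r0: "\<bar>r x\<^sub>0\<bar> < 1"
    using x\<^sub>0 by (simp add: r_def v1_inner inner_diff_left abs_divide)
  then have \<rho>: "0 \<le> \<rho>" "\<rho> < 1" by (simp_all add: \<rho>_def abs_square_less_1)
  have inv: "v\<^sub>1 \<bullet> X k > 0 \<and> \<bar>r (X k)\<bar> \<le> \<rho> ^ k * \<bar>r x\<^sub>0\<bar>" for k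
  proof (induction k)
    case 0
    then show ?case using x\<^sub>0 by (simp add: X_def v1_inner)
  next
    case (Suc k)
    have "\<rho> ^ k * \<bar>r x\<^sub>0\<bar> \<le> 1 * \<bar>r x\<^sub>0\<bar>"
      using \<rho> by (intro mult_right_mono power_le_one) auto
    with Suc have rk: "\<bar>r (X k)\<bar> \<le> \<bar>r x\<^sub>0\<bar>" by linarith
    with Suc r0 step have c: "v\<^sub>1 \<bullet> F (X k) > 0"
      and rF: "\<bar>r (F (X k))\<bar> \<le> \<bar>r (X k)\<bar> * (2 + (r (X k))\<^sup>2) / 3"
      by force+
    have "\<bar>r (X k)\<bar> * ((2 + (r (X k))\<^sup>2) / 3) \<le> (\<rho> ^ k * \<bar>r x\<^sub>0\<bar>) * \<rho>"
      unfolding \<rho>_def[symmetric]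
      using Suc \<rho> rk by (intro mult_mono) (auto simp: \<rho>_def abs_le_square_iff)
    with rF have "\<bar>r (F (X k))\<bar> \<le> \<rho> ^ Suc k * \<bar>r x\<^sub>0\<bar>" by (simp add: mult_ac)
    \<comment> \<open>This excludes the default iterate 0, so the normalization is a genuine
      positive scaling.\<close>
    moreover have "F (X k) \<noteq> 0" using c by auto
    ultimately show ?case using c by (simp add: X_Suc r_def)
  qed

  \<comment> \<open>A unit vector with positive \<open>v\<^sub>1\<close> component is determined by
    its ratio \<open>r\<close>. The index starts at 1 since \<open>x\<^sub>0\<close> need not be a
    unit vector; continuity of \<open>sgn\<close> at \<open>v\<^sub>1\<close> then gives the
    limit.\<close>
  have sgn: "X (Suc k) = sgn (v\<^sub>1 + (r (X (Suc k)) / 3) *\<^sub>R (v\<^sub>3 - v\<^sub>2))" for k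
  proof -
    let ?x = "X (Suc k)" and ?y = "v\<^sub>1 + (r (X (Suc k)) / 3) *\<^sub>R (v\<^sub>3 - v\<^sub>2)"
    have c: "v\<^sub>1 \<bullet> ?x > 0" using inv by blast
    have "?x = (v\<^sub>1 \<bullet> ?x) *\<^sub>R ?y"
      using c by (subst regular_2_simplex_frame_expansion[OF frame]) (simp add: r_def scaleR_add_right)
    then have "sgn ?x = sgn ?y" using c by (metis scaleR_one sgn_pos sgn_scaleR)
    moreover have "sgn ?x = ?x"
      unfolding X_Suc by (cases "F (X k) = 0") (simp_all add: sgn_div_norm)
    ultimately show ?thesis by simp
  qed
  have "(\<lambda>k. \<rho> ^ k * \<bar>r x\<^sub>0\<bar>) \<longlonglongrightarrow> 0"
    using \<rho> by (auto intro!: tendsto_mult_left_zero LIMSEQ_power_zero)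
  then have "(\<lambda>k. r (X k)) \<longlonglongrightarrow> 0"
    by (rule Lim_null_comparison[rotated]) (use inv in auto)
  then have "(\<lambda>k. r (X (Suc k))) \<longlonglongrightarrow> 0" by (rule LIMSEQ_Suc)
  then have "(\<lambda>k. sgn (v\<^sub>1 + (r (X (Suc k)) / 3) *\<^sub>R (v\<^sub>3 - v\<^sub>2)))
      \<longlonglongrightarrow> sgn (v\<^sub>1 + (0 / 3) *\<^sub>R (v\<^sub>3 - v\<^sub>2))"
    by (intro tendsto_intros) (use inner in auto)
  moreover have "sgn v\<^sub>1 = v\<^sub>1"
    using frame by (simp add: sgn_div_norm regular_2_simplex_frame_def)
  ultimately have "(\<lambda>k. X (Suc k)) \<longlonglongrightarrow> v\<^sub>1" using sgn by simp
  then show ?thesis unfolding X_def by (rule LIMSEQ_imp_Suc)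
qed

text \<open>Behind this is the identity that the sum of the
  \<open>(v\<^sub>i \<bullet> x) ^ 4\<close> is \<open>9 / 8 * norm x ^ 4\<close>: the contraction
  is a quarter of its gradient. The proof instead compares coefficients in the orthogonal basis
  \<open>v\<^sub>1\<close>, \<open>v\<^sub>3 - v\<^sub>2\<close>.\<close>

lemma tensor_contract_frame_tensor_4:
  assumes frame: "regular_2_simplex_frame v\<^sub>1 v\<^sub>2 v\<^sub>3"
  shows "tensor_contract 4 (frame_tensor 4 v\<^sub>1 v\<^sub>2 v\<^sub>3) x = (9 / 8 * (norm x)\<^sup>2) *\<^sub>R x"
proof -
  define c u where "c = v\<^sub>1 \<bullet> x" and "u = (v\<^sub>3 - v\<^sub>2) \<bullet> x"
  let ?e = "v\<^sub>3 - v\<^sub>2"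
  note inner = regular_2_simplex_frame_inner[OF frame]
  have x: "x = c *\<^sub>R v\<^sub>1 + (u / 3) *\<^sub>R ?e"
    unfolding c_def u_def by (rule regular_2_simplex_frame_expansion[OF frame])
  have v23: "v\<^sub>2 = (- 1 / 2) *\<^sub>R v\<^sub>1 - (1 / 2) *\<^sub>R ?e" "v\<^sub>3 = (- 1 / 2) *\<^sub>R v\<^sub>1 + (1 / 2) *\<^sub>R ?e"
    by (simp_all add: regular_2_simplex_frame_sum[OF frame] vec_eq_iff field_simps)
  have v23_x: "v\<^sub>2 \<bullet> x = - (c + u) / 2" "v\<^sub>3 \<bullet> x = (u - c) / 2"
    by (subst v23, simp add: c_def u_def inner_diff_left inner_add_left field_simps)+
  have "tensor_contract 4 (frame_tensor 4 v\<^sub>1 v\<^sub>2 v\<^sub>3) x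
      = (v\<^sub>1 \<bullet> x) ^ 3 *\<^sub>R v\<^sub>1 + (v\<^sub>2 \<bullet> x) ^ 3 *\<^sub>R v\<^sub>2 + (v\<^sub>3 \<bullet> x) ^ 3 *\<^sub>R v\<^sub>3"
    by (simp add: tensor_contract_frame_tensor)
  also have "\<dots> = c ^ 3 *\<^sub>R v\<^sub>1 + (- (c + u) / 2) ^ 3 *\<^sub>R v\<^sub>2 + ((u - c) / 2) ^ 3 *\<^sub>R v\<^sub>3"
    by (simp only: v23_x c_def)
  also have "\<dots> = (9 / 8 * (c\<^sup>2 + u\<^sup>2 / 3)) *\<^sub>R (c *\<^sub>R v\<^sub>1 + (u / 3) *\<^sub>R ?e)"
    by (simp add: regular_2_simplex_frame_sum[OF frame] vec_eq_iff field_simps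
        power2_eq_square power3_eq_cube)
  also have "c\<^sup>2 + u\<^sup>2 / 3 = (norm x)\<^sup>2"
    unfolding power2_norm_eq_inner
    by (subst (1 2) x) (simp add: inner inner_add_left inner_add_right inner_diff_left
        inner_diff_right power2_eq_square field_simps)
  finally show ?thesis using x by simp
qed

text \<open>In a linear order, a competitor that is not strictly smaller would be a second
  maximizer.\<close>

lemma ex1_is_arg_max_less:
  fixes f :: "'a \<Rightarrow> 'b::linorder"
  assumes "\<exists>!w. is_arg_max f P w" "is_arg_max f P v" "P u" "u \<noteq> v"
  shows "f u < f v"
proof (rule ccontr)
  assume "\<not> f u < f v"
  with assms(2,3) have "is_arg_max f P u" by (fastforce simp: is_arg_max_linorder)
  with assms(1,2,4) show False by blast
qed

theorem theorem4p7:
  fixes v\<^sub>1 v\<^sub>2 v\<^sub>3 :: "real ^ 2"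
  assumes "regular_2_simplex_frame v\<^sub>1 v\<^sub>2 v\<^sub>3"
  shows "(\<forall>(x\<^sub>0 :: real ^ 2) (v :: real ^ 2).
            (\<exists>!w. is_arg_max (\<lambda>u. u \<bullet> x\<^sub>0) (\<lambda>u. u \<in> {v\<^sub>1, - v\<^sub>1, v\<^sub>2, - v\<^sub>2, v\<^sub>3, - v\<^sub>3}) w) \<and>
            is_arg_max (\<lambda>u. u \<bullet> x\<^sub>0) (\<lambda>u. u \<in> {v\<^sub>1, - v\<^sub>1, v\<^sub>2, - v\<^sub>2, v\<^sub>3, - v\<^sub>3}) v \<longrightarrow>
            (\<forall>d :: nat. even d \<and> d \<ge> 6 \<longrightarrow>
               tensor_power_method d (frame_tensor d v\<^sub>1 v\<^sub>2 v\<^sub>3) x\<^sub>0 \<longlonglongrightarrow> v))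
       \<and> (\<forall>x\<^sub>0 :: real ^ 2. x\<^sub>0 \<noteq> 0 \<longrightarrow>
            tensor_power_method 4 (frame_tensor 4 v\<^sub>1 v\<^sub>2 v\<^sub>3) x\<^sub>0 1 = x\<^sub>0 /\<^sub>R norm x\<^sub>0)"
proof (intro conjI allI impI)
  fix x\<^sub>0 v :: "real ^ 2" and d :: nat
  let ?V = "{v\<^sub>1, - v\<^sub>1, v\<^sub>2, - v\<^sub>2, v\<^sub>3, - v\<^sub>3}"
  let ?max = "is_arg_max (\<lambda>u. u \<bullet> x\<^sub>0) (\<lambda>u. u \<in> ?V)"
  assume "(\<exists>!w. ?max w) \<and> ?max v" and "even d \<and> d \<ge> 6"
  then have uniq: "\<exists>!w. ?max w" and v: "?max v" and d: "even d" "d \<ge> 6"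
    by (iprover elim: conjE)+
  have less: "u \<bullet> x\<^sub>0 < v \<bullet> x\<^sub>0" if "u \<in> ?V" "u \<noteq> v" for u
    using ex1_is_arg_max_less[OF uniq v that] .
  \<comment> \<open>The symmetry reduction: \<open>v\<close> is completed to a frame with the same
    tensor. Strictly beating \<open>- w\<^sub>2\<close> makes
    \<open>w\<^sub>3 \<bullet> x\<^sub>0\<close> negative, and beating \<open>- w\<^sub>3\<close>
    does the same for \<open>w\<^sub>2\<close>.\<close>
  have main: "tensor_power_method d (frame_tensor d v\<^sub>1 v\<^sub>2 v\<^sub>3) x\<^sub>0 \<longlonglongrightarrow> v"
    if frame: "regular_2_simplex_frame v w\<^sub>2 w\<^sub>3" and w: "- w\<^sub>2 \<in> ?V" "- w\<^sub>3 \<in> ?V"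
      and T: "frame_tensor d v w\<^sub>2 w\<^sub>3 = frame_tensor d v\<^sub>1 v\<^sub>2 v\<^sub>3" for w\<^sub>2 w\<^sub>3
  proof -
    note inner = regular_2_simplex_frame_inner[OF frame]
    have "- w\<^sub>2 \<noteq> v" "- w\<^sub>3 \<noteq> v" using inner by auto
    with less w have "- w\<^sub>2 \<bullet> x\<^sub>0 < v \<bullet> x\<^sub>0" "- w\<^sub>3 \<bullet> x\<^sub>0 < v \<bullet> x\<^sub>0" by blast+
    moreover have "v \<bullet> x\<^sub>0 = - (w\<^sub>2 \<bullet> x\<^sub>0) - w\<^sub>3 \<bullet> x\<^sub>0"
      by (subst regular_2_simplex_frame_sum[OF frame]) (simp add: inner_diff_left)
    ultimately show ?thesis
      using tensor_power_method_tendsto[OF frame d, of x\<^sub>0] T by simp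
  qed
  note frame_simps = regular_2_simplex_frame_def frame_tensor_def inner_commute
    tensor_power_minus[OF d(1)] add_ac
  have "v \<in> ?V" using v by (simp add: is_arg_max_def)
  then consider "v = v\<^sub>1" | "v = - v\<^sub>1" | "v = v\<^sub>2" | "v = - v\<^sub>2" | "v = v\<^sub>3" | "v = - v\<^sub>3" by blast
  then show "tensor_power_method d (frame_tensor d v\<^sub>1 v\<^sub>2 v\<^sub>3) x\<^sub>0 \<longlonglongrightarrow> v"
  proof cases
    case 1
    show ?thesis by (rule main[of v\<^sub>2 v\<^sub>3]) (use assms 1 in \<open>auto simp: frame_simps\<close>)
  next
    case 2
    \<comment> \<open>For a negated maximizer the whole frame is negated; since \<open>d\<close> is
      even, the tensor stays the same.\<close>
    show ?thesis by (rule main[of "- v\<^sub>2" "- v\<^sub>3"]) (use assms 2 in \<open>auto simp: frame_simps\<close>)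
  next
    case 3
    show ?thesis by (rule main[of v\<^sub>1 v\<^sub>3]) (use assms 3 in \<open>auto simp: frame_simps\<close>)
  next
    case 4
    show ?thesis by (rule main[of "- v\<^sub>1" "- v\<^sub>3"]) (use assms 4 in \<open>auto simp: frame_simps\<close>)
  next
    case 5
    show ?thesis by (rule main[of v\<^sub>1 v\<^sub>2]) (use assms 5 in \<open>auto simp: frame_simps\<close>)
  next
    case 6
    show ?thesis by (rule main[of "- v\<^sub>1" "- v\<^sub>2"]) (use assms 6 in \<open>auto simp: frame_simps\<close>)
  qed
next
  fix x\<^sub>0 :: "real ^ 2"
  assume "x\<^sub>0 \<noteq> 0"
  \<comment> \<open>The contraction is a positive multiple of \<open>x\<^sub>0\<close>, and the
    factor cancels on normalization.\<close>
  then show "tensor_power_method 4 (frame_tensor 4 v\<^sub>1 v\<^sub>2 v\<^sub>3) x\<^sub>0 1 = x\<^sub>0 /\<^sub>R norm x\<^sub>0"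
    by (simp add: tensor_contract_frame_tensor_4[OF assms] Let_def field_simps)
qed

end
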